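(* Let $\mathcal{B}$ be the set of all blocking games. If $G\in\mathcal{P}_{\mathcal{B}}(\mathcal{B})$, then $G$ is $\mathcal{B}$-invertible. That is, $\mathcal{P}_{\mathcal{B}}(\mathcal{B})\leq\mathcal{B}^\times$.
   Context: Games are short combinatorial game forms played under the misère convention (a player unable to move wins). Outcomes $o(G)\in\{\mathscr{L},\mathscr{N},\mathscr{P},\mathscr{R}\}$ as usual ($\mathscr{P}$: second player wins), partially ordered by $\mathscr{L}>\mathscr{N}>\mathscr{R}$, $\mathscr{L}>\mathscr{P}>\mathscr{R}$, $\mathscr{N}$ and $\mathscr{P}$ incomparable. $G+H$ is the disjunctive sum, $\overline{G}$ the conjugate (roles swapped), $0=\{\cdot\mid\cdot\}$. A subposition of $G$ is any game reachable from $G$ by a possibly empty, not necessarily alternating, sequence of moves. A game is strictly $\mathscr{P}$-free if no subposition has outcome $\mathscr{P}$. For a set $\mathcal{A}$, $G\geq_{\mathcal{A}}H$ iff $o(G+X)\geq o(H+X)$ for all $X\in\mathcal{A}$, and $\equiv_{\mathcal{A}}$ is the associated equivalence. $\mathcal{P}_{\mathcal{A}}(\mathcal{A})$ is the set of $G\in\mathcal{A}$ with $G\equiv_{\mathcal{A}}H$ for some strictly $\mathscr{P}$-free $H\in\mathcal{A}$. A Left end is a game with no Left options. A Left end $X$ is blocked if for every Right option $X^R$, either $X^R$ is a blocked Left end or some Left option $X^{RL}$ of $X^R$ is a blocked Left end; blocked Right ends symmetrically. A game is blocking if every subposition that is a Left (resp. Right) end is a blocked Left (resp. Right) end; $\mathcal{B}$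 is the set of blocking games. $G\in\mathcal{A}$ is $\mathcal{A}$-invertible if there is $H\in\mathcal{A}$ with $G+H\equiv_{\mathcal{A}}0$; $\mathcal{A}^\times$ is the set of $\mathcal{A}$-invertible elements. For $T\subseteq\mathcal{A}$, $T\leq\mathcal{A}^\times$ means $T\subseteq\mathcal{A}^\times$ and the $\equiv_{\mathcal{A}}$-classes of elements of $T$ form a subgroup of the group of $\equiv_{\mathcal{A}}$-classes of $\mathcal{A}^\times$ under $+$. *)

theory Defs
  imports "HOL-Library.FSet" "HOL-Algebra.Group"
begin

datatype player = Left | Right

fun opponent :: "player \<Rightarrow> player" where
  "opponent Left = Right"
| "opponent Right = Left"

datatype game = Game (left_opts: "game fset") (right_opts: "game fset")

fun opts :: "player \<Rightarrow> game \<Rightarrow> game fset" where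
  "opts Left G = left_opts G"
| "opts Right G = right_opts G"

lemma size_opts: "G' |\<in>| opts p G \<Longrightarrow> size G' < size G"
proof -
  have le: "Suc (size x) \<le> (\<Sum>x\<in>fset A. Suc (size x))" if "x |\<in>| A" for x :: game and A
    using that by (intro member_le_sum) auto
  assume "G' |\<in>| opts p G"
  then show ?thesis
    by (cases G; cases p) (auto simp: less_Suc_eq_le dest!: le)
qed

lemmas size_left_opts = size_opts[of _ Left, simplified]
lemmas size_right_opts = size_opts[of _ Right, simplified]

definition is_end :: "player \<Rightarrow> game \<Rightarrow> bool" where
  "is_end p G \<longleftrightarrow> opts p G = {||}"

definition subposition :: "game \<Rightarrow> game \<Rightarrow> bool" where
  "subposition H G \<longleftrightarrow> (\<lambda>K K'. \<exists>p. K' |\<in>| opts p K)\<^sup>*\<^sup>* G H"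

instantiation game :: zero
begin
definition zero_game :: game where "0 = Game {||} {||}"
instance ..
end

instantiation game :: plus
begin
function plus_game :: "game \<Rightarrow> game \<Rightarrow> game" where
  "plus_game G H = Game
     ((\<lambda>G'. plus_game G' H) |`| left_opts G |\<union>| (\<lambda>H'. plus_game G H') |`| left_opts H)
     ((\<lambda>G'. plus_game G' H) |`| right_opts G |\<union>| (\<lambda>H'. plus_game G H') |`| right_opts H)"
  by pat_completeness auto
termination
  by (relation "measure (\<lambda>(G, H). size G + size H)")
    (auto dest: size_left_opts size_right_opts)
instance ..
end

declare plus_game.simps [simp del]

text \<open>Misere play: a player who is to move and has no move wins.\<close>

function wins_first :: "player \<Rightarrow> game \<Rightarrow> bool" where
  "wins_first p G \<longleftrightarrow>
     is_end p G \<or> (\<exists>G' |\<in>| opts p G. \<not> wins_first (opponent p) G')"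
  by pat_completeness auto
termination
  by (relation "measure (\<lambda>(p, G). size G)") (auto dest: size_opts)

declare wins_first.simps [simp del]

datatype outcome = L_outcome | N_outcome | P_outcome | R_outcome

instantiation outcome :: order
begin

definition less_eq_outcome :: "outcome \<Rightarrow> outcome \<Rightarrow> bool" where
  "a \<le> b \<longleftrightarrow> a = b \<or> a = R_outcome \<or> b = L_outcome"

definition less_outcome :: "outcome \<Rightarrow> outcome \<Rightarrow> bool" where
  "(a::outcome) < b \<longleftrightarrow> a \<le> b \<and> a \<noteq> b"

instance
  by standard (auto simp: less_eq_outcome_def less_outcome_def)

end

definition outcome :: "game \<Rightarrow> outcome" where
  "outcome G =
     (if wins_first Left G
      then (if wins_first Right G then N_outcome else L_outcome)
      else (if wins_first Right G then R_outcome else P_outcome))"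

definition strictly_P_free :: "game \<Rightarrow> bool" where
  "strictly_P_free G \<longleftrightarrow> (\<forall>H. subposition H G \<longrightarrow> outcome H \<noteq> P_outcome)"

definition geq_mod :: "game set \<Rightarrow> game \<Rightarrow> game \<Rightarrow> bool" where
  "geq_mod \<A> G H \<longleftrightarrow> (\<forall>X\<in>\<A>. outcome (G + X) \<ge> outcome (H + X))"

definition equiv_mod :: "game set \<Rightarrow> game \<Rightarrow> game \<Rightarrow> bool" where
  "equiv_mod \<A> G H \<longleftrightarrow> geq_mod \<A> G H \<and> geq_mod \<A> H G"

definition P_free_part :: "game set \<Rightarrow> game set" where
  "P_free_part \<A> = {G \<in> \<A>. \<exists>H\<in>\<A>. strictly_P_free H \<and> equiv_mod \<A> G H}"

text \<open>The recursion is well-founded, so the least fixed point is the only solution.\<close>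

inductive blocked_end :: "player \<Rightarrow> game \<Rightarrow> bool" for p where
  "is_end p X \<Longrightarrow>
   (\<forall>X'. X' |\<in>| opts (opponent p) X \<longrightarrow>
      blocked_end p X' \<or> (\<exists>X''. X'' |\<in>| opts p X' \<and> blocked_end p X'')) \<Longrightarrow>
   blocked_end p X"

definition blocking :: "game \<Rightarrow> bool" where
  "blocking G \<longleftrightarrow> (\<forall>H p. subposition H G \<longrightarrow> is_end p H \<longrightarrow> blocked_end p H)"

definition blocking_games :: "game set" where
  "blocking_games = {G. blocking G}"

definition invertible_in :: "game set \<Rightarrow> game \<Rightarrow> bool" where
  "invertible_in \<A> G \<longleftrightarrow> G \<in> \<A> \<and> (\<exists>H\<in>\<A>. equiv_mod \<A> (G + H) 0)"

definition invertibles :: "game set \<Rightarrow> game set" where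
  "invertibles \<A> = {G. invertible_in \<A> G}"

definition equiv_rel :: "game set \<Rightarrow> (game \<times> game) set" where
  "equiv_rel \<A> = {(G, H). G \<in> \<A> \<and> H \<in> \<A> \<and> equiv_mod \<A> G H}"

text \<open>
  The product of two classes is the class of the sum of any representatives;
  the union over all representatives avoids a choice.
\<close>

definition invertible_classes :: "game set \<Rightarrow> game set monoid" where
  "invertible_classes \<A> =
     \<lparr>carrier = invertibles \<A> // equiv_rel \<A>,
      mult = (\<lambda>C D. \<Union>G\<in>C. \<Union>H\<in>D. equiv_rel \<A> `` {G + H}),
      one = equiv_rel \<A> `` {0}\<rparr>"

definition subgroup_of_invertibles :: "game set \<Rightarrow> game set \<Rightarrow> bool" where
  "subgroup_of_invertibles T \<A> \<longleftrightarrow>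
     T \<subseteq> invertibles \<A> \<and>
     group (invertible_classes \<A>) \<and>
     subgroup (T // equiv_rel \<A>) (invertible_classes \<A>)"

end

theory Submission
  imports Defs
begin

text \<open>
  The heart of the matter is that a sum \<open>G + H\<close> of strictly P-free blocking games never has
  outcome P, so that such games are closed under sums. Positions won by the second player are
  closed under sums as long as every end met on the way is blocked. In a minimal counterexample
  \<open>G + H\<close>, both players have second-player winning strategies. Take many copies of \<open>G\<close> and \<open>H\<close> in
  a row, pair each \<open>G\<close> with its right neighbour for one player and with its left neighbour for the
  other, and let each player answer every move inside the pair it touches. The exchange runs along
  the row until two copies have reached the same position, and the sum of the stretch between them
  is then a win for either player moving second, which is absurd; blocked ends rule out
  that the exchange stops early.

  Hence \<open>G\<close> plus its conjugate has outcome N for each strictly P-free blocking \<open>G\<close>, and a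
  mirror strategy shows that this sum is equivalent to \<open>0\<close>.
\<close>

section \<open>Sums, subpositions and blocked ends\<close>

lemma opponent_opponent [simp]: "opponent (opponent p) = p"
  by (cases p) auto

lemma opponent_neq [simp]: "opponent p \<noteq> p" "p \<noteq> opponent p"
  by (cases p; simp)+

lemma game_eqI: "(\<And>p. opts p G = opts p H) \<Longrightarrow> G = H"
  by (metis game.expand opts.simps)

lemma opts_zero [simp]: "opts p 0 = {||}"
  by (cases p) (auto simp: zero_game_def)

lemma opts_plus: "opts p (G + H) = (\<lambda>G'. G' + H) |`| opts p G |\<union>| (\<lambda>H'. G + H') |`| opts p H"
  by (cases p) (subst plus_game.simps, simp)+

lemma opts_plusE:
  assumes "X |\<in>| opts p (G + H)"
  obtains G' where "G' |\<in>| opts p G" "X = G' + H" | H' where "H' |\<in>| opts p H" "X = G + H'"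
  using assms by (auto simp: opts_plus)

lemma opts_plusI1: "G' |\<in>| opts p G \<Longrightarrow> G' + H |\<in>| opts p (G + H)"
  and opts_plusI2: "H' |\<in>| opts p H \<Longrightarrow> G + H' |\<in>| opts p (G + H)"
  by (auto simp: opts_plus)

lemma is_end_plus [simp]: "is_end p (G + H) \<longleftrightarrow> is_end p G \<and> is_end p H"
  by (auto simp: is_end_def opts_plus)

lemma is_end_zero [simp]: "is_end p 0"
  by (simp add: is_end_def)

lemma not_is_endE:
  assumes "\<not> is_end p G"
  obtains G' where "G' |\<in>| opts p G"
  using assms by (auto simp: is_end_def)

lemma game_plus_commute: "(G::game) + H = H + G"
proof (induction "size G + size H" arbitrary: G H rule: less_induct)
  case less
  have "opts p (G + H) = opts p (H + G)" for p
  proof -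
    have "(\<lambda>G'. G' + H) |`| opts p G = (\<lambda>G'. H + G') |`| opts p G"
      by (intro fset.map_cong refl less) (auto dest: size_opts)
    moreover have "(\<lambda>H'. G + H') |`| opts p H = (\<lambda>H'. H' + G) |`| opts p H"
      by (intro fset.map_cong refl less) (auto dest: size_opts)
    ultimately show ?thesis by (auto simp: opts_plus)
  qed
  then show ?case by (rule game_eqI)
qed

lemma game_plus_assoc: "(G::game) + H + K = G + (H + K)"
proof (induction "size G + size H + size K" arbitrary: G H K rule: less_induct)
  case less
  have "opts p (G + H + K) = opts p (G + (H + K))" for p
  proof -
    have "(\<lambda>G'. G' + H + K) |`| opts p G = (\<lambda>G'. G' + (H + K)) |`| opts p G"
      by (intro fset.map_cong refl less) (auto dest: size_opts)
    moreover have "(\<lambda>H'. G + H' + K) |`| opts p H = (\<lambda>H'. G + (H' + K)) |`| opts p H"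
      by (intro fset.map_cong refl less) (auto dest: size_opts)
    moreover have "(\<lambda>K'. G + H + K') |`| opts p K = (\<lambda>K'. G + (H + K')) |`| opts p K"
      by (intro fset.map_cong refl less) (auto dest: size_opts)
    ultimately show ?thesis
      by (simp add: opts_plus fimage_funion comp_def funion_assoc)
  qed
  then show ?case by (rule game_eqI)
qed

lemma game_plus_left_commute: "(G::game) + (H + K) = H + (G + K)"
  by (metis game_plus_assoc game_plus_commute)

lemmas game_plus_ac = game_plus_assoc game_plus_commute game_plus_left_commute

lemma game_plus_zero [simp]: "(G::game) + 0 = G"
proof (induction "size G" arbitrary: G rule: less_induct)
  case less
  have "(\<lambda>G'. G' + 0) |`| opts p G = id |`| opts p G" for p
    by (intro fset.map_cong refl) (auto intro!: less dest: size_opts)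
  then show ?case by (intro game_eqI) (simp add: opts_plus)
qed

lemma game_zero_plus [simp]: "0 + (G::game) = G"
  by (metis game_plus_commute game_plus_zero)

section \<open>Subpositions\<close>

lemma subposition_refl [simp]: "subposition G G"
  by (simp add: subposition_def)

lemma subposition_trans: "subposition K H \<Longrightarrow> subposition H G \<Longrightarrow> subposition K G"
  by (auto simp: subposition_def)

lemma subposition_opts: "H |\<in>| opts p G \<Longrightarrow> subposition H G"
  by (auto simp: subposition_def)

lemma subposition_induct [consumes 1, case_names refl step]:
  assumes "subposition H G" "P G"
    "\<And>K K' p. subposition K G \<Longrightarrow> P K \<Longrightarrow> K' |\<in>| opts p K \<Longrightarrow> P K'"
  shows "P H"
  using assms(1) unfolding subposition_def
  by (induction rule: rtranclp_induct) (use assms(2,3) in \<open>auto simp: subposition_def\<close>)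

lemma size_subposition: "subposition H G \<Longrightarrow> H = G \<or> size H < size G"
  by (induction rule: subposition_induct) (auto dest: size_opts)

lemma finite_subpositions: "finite {H. subposition H G}"
proof (induction "size G" arbitrary: G rule: less_induct)
  case less
  let ?O = "fset (opts Left G) \<union> fset (opts Right G)"
  have "H \<in> insert G (\<Union>K\<in>?O. {H. subposition H K})" if "subposition H G" for H
    using that[unfolded subposition_def]
  proof (cases rule: converse_rtranclpE)
    case (step K)
    then obtain p where "K |\<in>| opts p G" by blast
    then have "K \<in> ?O" by (cases p) auto
    then show ?thesis using step(2) unfolding subposition_def by blast
  qed simp
  then have "{H. subposition H G} \<subseteq> insert G (\<Union>K\<in>?O. {H. subposition H K})"
    by blast
  moreover have "finite {H. subposition H K}" if "K \<in> ?O" for K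
    using that by (intro less) (auto dest: size_left_opts size_right_opts)
  ultimately show ?case
    by (meson finite_insert finite_UN_I finite_UnI finite_fset finite_subset)
qed

lemma subposition_plusE:
  assumes "subposition X (G + H)"
  obtains G' H' where "subposition G' G" "subposition H' H" "X = G' + H'"
proof -
  from assms have "\<exists>G' H'. subposition G' G \<and> subposition H' H \<and> X = G' + H'"
  proof (induction rule: subposition_induct)
    case refl
    show ?case using subposition_refl by blast
  next
    case (step K K' p)
    then obtain G' H' where GH: "subposition G' G" "subposition H' H" "K = G' + H'" by blast
    from \<open>K' |\<in>| opts p K\<close> have "K' |\<in>| opts p (G' + H')" using GH(3) by simp
    then show ?case
      by (cases rule: opts_plusE) (use GH subposition_trans[OF subposition_opts] in blast)+
  qed
  then show thesis using that by blast
qed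

text \<open>Each opposing move is dealt with in the summand where it was made: that summand either
  is still a blocked end or can be turned into one by a reply, and the other summand is
  untouched.\<close>

lemma blocked_end_plus: "blocked_end p X \<Longrightarrow> blocked_end p Y \<Longrightarrow> blocked_end p (X + Y)"
proof (induction "size X + size Y" arbitrary: X Y rule: less_induct)
  case less
  \<comment> \<open>Stated for arbitrary summands, with the induction hypothesis as a premise, so
    that commutativity also yields the case of a move in the second summand.\<close>
  have *: "blocked_end p (X' + Y) \<or> (\<exists>X''. X'' |\<in>| opts p (X' + Y) \<and> blocked_end p X'')"
    if hyps: "X' |\<in>| opts (opponent p) X" "blocked_end p X" "blocked_end p Y"
      and IH: "\<And>Z. size Z < size X \<Longrightarrow> blocked_end p Z \<Longrightarrow> blocked_end p (Z + Y)" for X X' Y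
  proof -
    have "blocked_end p X' \<or> (\<exists>X''. X'' |\<in>| opts p X' \<and> blocked_end p X'')"
      using hyps by (meson blocked_end.cases)
    then show ?thesis
    proof (elim disjE exE conjE)
      fix X'' assume "X'' |\<in>| opts p X'" "blocked_end p X''"
      moreover from this hyps have "size X'' < size X" by (meson less_trans size_opts)
      ultimately show ?thesis using IH opts_plusI1 by blast
    qed (use IH hyps size_opts in blast)
  qed
  show ?case
  proof (rule blocked_end.intros)
    show "is_end p (X + Y)" using less.prems by (auto elim: blocked_end.cases)
    show "\<forall>X'. X' |\<in>| opts (opponent p) (X + Y) \<longrightarrow>
      blocked_end p X' \<or> (\<exists>X''. X'' |\<in>| opts p X' \<and> blocked_end p X'')"
    proof (intro allI impI)
      fix Z assume "Z |\<in>| opts (opponent p) (X + Y)"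
      then show "blocked_end p Z \<or> (\<exists>X''. X'' |\<in>| opts p Z \<and> blocked_end p X'')"
      proof (cases rule: opts_plusE)
        case (1 X')
        then show ?thesis using *[of X' X Y] less by simp
      next
        case (2 Y')
        have "blocked_end p (Z + X)" if "size Z < size Y" "blocked_end p Z" for Z
          using less.hyps[of X Z] less.prems that by (simp add: game_plus_commute)
        with 2 show ?thesis using *[of Y' Y X] less.prems by (simp add: game_plus_commute)
      qed
    qed
  qed
qed

lemma blocking_subposition: "blocking G \<Longrightarrow> subposition H G \<Longrightarrow> blocking H"
  unfolding blocking_def using subposition_trans by blast

lemma blocking_plus: "blocking G \<Longrightarrow> blocking H \<Longrightarrow> blocking (G + H)"
  unfolding blocking_def by (metis blocked_end_plus is_end_plus subposition_plusE)

lemma blocked_end_zero: "blocked_end p 0"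
  by (rule blocked_end.intros) auto

lemma subposition_zeroD: "subposition H 0 \<Longrightarrow> H = 0"
  by (induction rule: subposition_induct) auto

lemma blocking_zero: "blocking 0"
  unfolding blocking_def using blocked_end_zero subposition_zeroD by blast

section \<open>Winning and strict P-freeness\<close>

lemma wins_first_end: "is_end p G \<Longrightarrow> wins_first p G"
  by (subst wins_first.simps) simp

lemma wins_first_move: "G' |\<in>| opts p G \<Longrightarrow> \<not> wins_first (opponent p) G' \<Longrightarrow> wins_first p G"
  by (subst wins_first.simps) blast

lemma wins_firstE:
  assumes "wins_first p G"
  obtains "is_end p G" | G' where "G' |\<in>| opts p G" "\<not> wins_first (opponent p) G'"
  using assms by (subst (asm) wins_first.simps) blast

lemma outcome_P_iff: "outcome G = P_outcome \<longleftrightarrow> (\<forall>p. \<not> wins_first p G)"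
  by (metis (full_types) outcome.distinct outcome_def player.exhaust)

lemma strictly_P_free_iff: "strictly_P_free G \<longleftrightarrow> (\<forall>H. subposition H G \<longrightarrow> (\<exists>p. wins_first p H))"
  by (simp add: strictly_P_free_def outcome_P_iff)

lemma strictly_P_free_subposition: "strictly_P_free G \<Longrightarrow> subposition H G \<Longrightarrow> strictly_P_free H"
  unfolding strictly_P_free_def using subposition_trans by blast

lemma strictly_P_free_wins: "strictly_P_free G \<Longrightarrow> wins_first p G \<or> wins_first (opponent p) G"
  unfolding strictly_P_free_iff by (metis opponent.simps player.exhaust subposition_refl)

section \<open>Safe positions\<close>

text \<open>
  A player holding one of these positions wins moving first, respectively second, with a
  strategy that only ever runs out of moves at a blocked end. Unlike plain winning, this
  survives adding further such positions.
\<close>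

inductive first_safe :: "player \<Rightarrow> game \<Rightarrow> bool" and second_safe :: "player \<Rightarrow> game \<Rightarrow> bool"
  for p where
  first_safe_end: "blocked_end p X \<Longrightarrow> first_safe p X"
| first_safe_move: "X' |\<in>| opts p X \<Longrightarrow> second_safe p X' \<Longrightarrow> first_safe p X"
| second_safeI: "\<not> is_end (opponent p) X \<Longrightarrow> first_safe p X \<Longrightarrow>
    (\<And>X'. X' |\<in>| opts (opponent p) X \<Longrightarrow> first_safe p X') \<Longrightarrow> second_safe p X"

lemma second_safe_imp_first_safe: "second_safe p X \<Longrightarrow> first_safe p X"
  by (erule second_safe.cases) blast

lemma second_safe_option: "second_safe p X \<Longrightarrow> X' |\<in>| opts (opponent p) X \<Longrightarrow> first_safe p X'"
  by (erule second_safe.cases) blast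

lemma second_safe_not_end: "second_safe p X \<Longrightarrow> \<not> is_end (opponent p) X"
  by (erule second_safe.cases) blast

lemma blocked_end_is_end: "blocked_end p X \<Longrightarrow> is_end p X"
  by (erule blocked_end.cases) blast

text \<open>Opposing moves in \<open>E\<close> are answered inside \<open>E\<close> by the reply
  that makes it a blocked end again, if it is not one already; all other play follows the strategy
  for \<open>Y\<close>.\<close>

lemma blocked_plus_safe:
  assumes "blocked_end p E"
  shows "(second_safe p Y \<longrightarrow> second_safe p (E + Y)) \<and> (first_safe p Y \<longrightarrow> first_safe p (E + Y))"
  using assms
proof (induction "size E + size Y" arbitrary: E Y rule: less_induct)
  case less
  have first: "first_safe p (E + Y)" if "first_safe p Y"
    using that
  proof cases
    case first_safe_end
    then show ?thesis using less.prems blocked_end_plus first_safe_second_safe.first_safe_end by blast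
  next
    case (first_safe_move Y')
    then have "second_safe p (E + Y')" using less size_opts by simp
    then show ?thesis
      using first_safe_move(1) opts_plusI2 first_safe_second_safe.first_safe_move by blast
  qed
  moreover have "second_safe p (E + Y)" if Y: "second_safe p Y"
  proof (rule second_safeI)
    show "\<not> is_end (opponent p) (E + Y)" using second_safe_not_end[OF Y] by simp
    show "first_safe p (E + Y)" using Y first second_safe_imp_first_safe by blast
    fix Z assume "Z |\<in>| opts (opponent p) (E + Y)"
    then show "first_safe p Z"
    proof (cases rule: opts_plusE)
      case (1 E')
      then have "blocked_end p E' \<or> (\<exists>E''. E'' |\<in>| opts p E' \<and> blocked_end p E'')"
        using less.prems by (meson blocked_end.cases)
      then show ?thesis
      proof (elim disjE exE conjE)
        \<comment> \<open>No reply in \<open>E'\<close> is possible, so \<open>p\<close> has to move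
          in \<open>Y\<close>. This is why second safe positions are required to be first safe as
          well.\<close>
        assume "blocked_end p E'"
        then show ?thesis
          using less.hyps[of E' Y] 1 Y size_opts second_safe_imp_first_safe by fastforce
      next
        fix E'' assume E'': "E'' |\<in>| opts p E'" "blocked_end p E''"
        then have "size E'' < size E" using size_opts[OF E''(1)] size_opts[OF 1(1)] by simp
        then have "second_safe p (E'' + Y)" using less.hyps[of E'' Y] E'' Y by simp
        then show ?thesis using E'' 1 opts_plusI1 first_safe_move by blast
      qed
    next
      case (2 Y')
      then show ?thesis using less.hyps[of E Y'] less.prems Y second_safe_option size_opts by simp
    qed
  qed
  ultimately show ?case by blast
qed

text \<open>Every opposing move is answered in the summand where it is made. If a first safe
  \<open>X\<close> is a blocked end, then \<open>p\<close> cannot move in it, and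
  \<open>blocked_plus_safe\<close> applies because \<open>Y\<close> is first safe too.\<close>

lemma safe_plus_safe:
  "(second_safe p X \<and> second_safe p Y \<longrightarrow> second_safe p (X + Y)) \<and>
   (first_safe p X \<and> second_safe p Y \<longrightarrow> first_safe p (X + Y))"
proof (induction "size X + size Y" arbitrary: X Y rule: less_induct)
  case less
  have first: "first_safe p (X + Y)"
    if XY: "first_safe p X" "second_safe p Y"
      and IH: "\<And>X'. size X' < size X \<Longrightarrow> second_safe p X' \<Longrightarrow> second_safe p (X' + Y)" for X Y
    using XY(1)
  proof cases
    case first_safe_end
    then show ?thesis using XY blocked_plus_safe second_safe_imp_first_safe by blast
  next
    case (first_safe_move X')
    then show ?thesis
      by (meson IH first_safe_second_safe.first_safe_move opts_plusI1 size_opts)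
  qed
  have "first_safe p (X + Y)" if "first_safe p X" "second_safe p Y"
    using that less by (intro first) auto
  moreover have "second_safe p (X + Y)" if XY: "second_safe p X" "second_safe p Y"
  proof (rule second_safeI)
    show "\<not> is_end (opponent p) (X + Y)" using second_safe_not_end XY by simp
    show "first_safe p (X + Y)"
      using XY less by (intro first second_safe_imp_first_safe) auto
    fix Z assume "Z |\<in>| opts (opponent p) (X + Y)"
    then show "first_safe p Z"
    proof (cases rule: opts_plusE)
      case (1 X')
      then show ?thesis using less[of X' Y] XY second_safe_option size_opts by simp
    next
      case (2 Y')
      have "first_safe p (Y' + X)"
        using 2 XY less.hyps[of X] size_opts[OF 2(1)] second_safe_option
        by (intro first) (auto simp: game_plus_commute)
      then show ?thesis using 2 by (simp add: game_plus_commute)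
    qed
  qed
  ultimately show ?case by blast
qed

lemma blocked_plus_second_safe: "blocked_end p E \<Longrightarrow> second_safe p Y \<Longrightarrow> second_safe p (E + Y)"
  and blocked_plus_first_safe: "blocked_end p E \<Longrightarrow> first_safe p Y \<Longrightarrow> first_safe p (E + Y)"
  and second_safe_plus: "second_safe p X \<Longrightarrow> second_safe p Y \<Longrightarrow> second_safe p (X + Y)"
  and first_safe_plus: "first_safe p X \<Longrightarrow> second_safe p Y \<Longrightarrow> first_safe p (X + Y)"
  using blocked_plus_safe safe_plus_safe by blast+

lemma safe_wins:
  "(first_safe p X \<longrightarrow> wins_first p X) \<and> (second_safe p X \<longrightarrow> \<not> wins_first (opponent p) X)"
proof (induction "size X" arbitrary: X rule: less_induct)
  case less
  have "wins_first p X" if "first_safe p X"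
    using that
  proof cases
    case first_safe_end
    then show ?thesis by (simp add: blocked_end_is_end wins_first_end)
  next
    case (first_safe_move X')
    then show ?thesis using less size_opts wins_first_move by blast
  qed
  moreover have "\<not> wins_first (opponent p) X" if X: "second_safe p X"
  proof
    assume "wins_first (opponent p) X"
    then show False
    proof (cases rule: wins_firstE)
      case 1
      then show ?thesis using X second_safe_not_end by blast
    next
      case (2 X')
      then show ?thesis using less[of X'] X second_safe_option size_opts by auto
    qed
  qed
  ultimately show ?case by blast
qed

lemma first_safe_wins: "first_safe p X \<Longrightarrow> wins_first p X"
  and second_safe_wins: "second_safe p X \<Longrightarrow> \<not> wins_first (opponent p) X"
  using safe_wins by blast+

lemma second_safe_wins_first: "second_safe p X \<Longrightarrow> wins_first p X"
  using first_safe_wins second_safe_imp_first_safe by blast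

text \<open>All ends of a blocking game are blocked. Strict P-freeness ensures that a player who
  wins moving second also wins moving first, as \<open>second_safe\<close> demands.\<close>

lemma wins_safe:
  assumes "strictly_P_free X" "blocking X"
  shows "(wins_first p X \<longrightarrow> first_safe p X) \<and> (\<not> wins_first (opponent p) X \<longrightarrow> second_safe p X)"
  using assms
proof (induction "size X" arbitrary: X rule: less_induct)
  case less
  have IH: "(wins_first p X' \<longrightarrow> first_safe p X') \<and> (\<not> wins_first (opponent p) X' \<longrightarrow> second_safe p X')"
    if "X' |\<in>| opts q X" for X' q
    using that less size_opts strictly_P_free_subposition blocking_subposition subposition_opts by blast
  have first: "first_safe p X" if "wins_first p X"
    using that
  proof (cases rule: wins_firstE)
    case 1
    then show ?thesis
      using less.prems(2) unfolding blocking_def using first_safe_end subposition_refl by blast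
  next
    case (2 X')
    then show ?thesis using IH first_safe_move by blast
  qed
  moreover have "second_safe p X" if X: "\<not> wins_first (opponent p) X"
  proof (rule second_safeI)
    show "\<not> is_end (opponent p) X" using X wins_first_end by blast
    show "first_safe p X" using X first strictly_P_free_wins[OF less.prems(1)] by blast
    fix X' assume X': "X' |\<in>| opts (opponent p) X"
    then have "wins_first p X'" using X wins_first_move[OF X'] by auto
    then show "first_safe p X'" using IH X' by blast
  qed
  ultimately show ?case by blast
qed

lemma first_safe_of_wins: "strictly_P_free X \<Longrightarrow> blocking X \<Longrightarrow> wins_first p X \<Longrightarrow> first_safe p X"
  and second_safe_of_wins:
    "strictly_P_free X \<Longrightarrow> blocking X \<Longrightarrow> \<not> wins_first (opponent p) X \<Longrightarrow> second_safe p X"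
  using wins_safe by blast+

section \<open>Sums of strictly P-free blocking games\<close>

text \<open>A minimal pair whose sum has outcome P; the locale is shown to be contradictory.\<close>

locale critical_pair =
  fixes K :: "player \<Rightarrow> game"
  assumes pair_safe: "\<lbrakk>subposition y (K p); subposition x (K (opponent p));
      y \<noteq> K p \<or> x \<noteq> K (opponent p); \<not> wins_first (opponent p) (y + x)\<rbrakk> \<Longrightarrow> second_safe p (y + x)"
    and sum_P: "\<not> wins_first q (K p + K (opponent p))"
    and K_safe: "first_safe p (K p)"
    and K_not_end: "\<not> is_end (opponent p) (K p)"
    and K_blocking: "blocking (K p)"
begin

text \<open>
  The positions of \<open>K p\<close> that start a chain of positions taken alternately from \<open>K p\<close> and
  \<open>K (opponent p)\<close>, ending in some \<open>K q\<close> itself, such that the sums of consecutive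
  positions are won alternately by \<open>p\<close> and by the opponent, in each case moving second.
\<close>

inductive chain_start :: "player \<Rightarrow> game \<Rightarrow> bool" where
  base: "chain_start p (K p)"
| link: "chain_start (opponent p) x \<Longrightarrow> subposition y (K p) \<Longrightarrow> \<not> wins_first (opponent p) (y + x)
    \<Longrightarrow> chain_start p y"

lemma chain_start_subposition: "chain_start p y \<Longrightarrow> subposition y (K p)"
  by (erule chain_start.cases) auto

text \<open>Even the last position \<open>K p\<close> of a chain has a partner, namely
  \<open>K (opponent p)\<close>, by \<open>sum_P\<close>.\<close>

lemma chain_start_partner:
  assumes "chain_start p y"
  obtains x where "chain_start (opponent p) x" "\<not> wins_first (opponent p) (y + x)"
  using assms that base sum_P by (cases rule: chain_start.cases) blast+

text \<open>Here \<open>S\<close> is the sum of the remaining positions of the chain.\<close>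

lemma chain_start_rest:
  assumes "chain_start p y"
  shows "y = K p \<or> (\<exists>S. first_safe (opponent p) S \<and> second_safe p (y + S) \<or>
    second_safe (opponent p) S \<and> first_safe p (y + S))"
  using assms
proof induction
  case (base p)
  then show ?case by simp
next
  case (link p x y)
  show ?case
  proof (cases "y = K p \<and> x = K (opponent p)")
    case False
    have yx: "second_safe p (y + x)"
      using pair_safe link False chain_start_subposition by blast
    \<comment> \<open>The new tail is \<open>x\<close> alone or \<open>x + S\<close>. Its safety for
      the opponent is \<open>K_safe\<close> or the induction hypothesis; for \<open>p\<close>, the
      safe pair \<open>y + x\<close> is split off and the old tail kept.\<close>
    from link.IH show ?thesis
    proof (elim disjE exE conjE)
      assume "x = K (opponent p)"
      then show ?thesis using yx K_safe by blast
    next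
      fix S assume S: "first_safe (opponent (opponent p)) S" "second_safe (opponent p) (x + S)"
      have "first_safe p (y + (x + S))"
        using first_safe_plus[of p S "y + x"] S yx by (simp add: game_plus_ac)
      then show ?thesis using S by blast
    next
      fix S assume S: "second_safe (opponent (opponent p)) S" "first_safe (opponent p) (x + S)"
      have "second_safe p (y + (x + S))"
        using second_safe_plus[of p S "y + x"] S yx by (simp add: game_plus_ac)
      then show ?thesis using S by blast
    qed
  qed simp
qed

text \<open>An end would be blocked, so adding \<open>y\<close> to the tail \<open>S\<close> would
  preserve the opponent's safety in \<open>S\<close>. The opponent would then win
  \<open>y + S\<close> in the very role in which \<open>p\<close>'s safety makes the opponent
  lose.\<close>

lemma chain_start_not_end:
  assumes "chain_start p y"
  shows "\<not> is_end (opponent p) y"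
proof
  assume "is_end (opponent p) y"
  then have y: "blocked_end (opponent p) y" "y \<noteq> K p"
    using chain_start_subposition[OF assms] K_blocking[of p] K_not_end
    unfolding blocking_def by blast+
  from chain_start_rest[OF assms] y(2) obtain S where
    "first_safe (opponent p) S \<and> second_safe p (y + S) \<or>
     second_safe (opponent p) S \<and> first_safe p (y + S)" by blast
  then show False
  proof (elim disjE conjE)
    assume "first_safe (opponent p) S" "second_safe p (y + S)"
    then show False
      using y(1) blocked_plus_first_safe first_safe_wins second_safe_wins by blast
  next
    assume "second_safe (opponent p) S" "first_safe p (y + S)"
    then show False
      using y(1) blocked_plus_second_safe[of "opponent p" y S] first_safe_wins
        second_safe_wins[of "opponent p" "y + S"] by auto
  qed
qed

text \<open>
  The positions in which \<open>p\<close> is to answer a move of the opponent and has no answer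
  that leaves a chain, so that the answer has to be made in the next position.
\<close>

definition pending :: "player \<Rightarrow> game \<Rightarrow> bool" where
  "pending p a \<longleftrightarrow> subposition a (K p) \<and>
     (\<exists>y. chain_start (opponent p) y \<and> wins_first p (a + y)) \<and>
     (\<forall>a'. a' |\<in>| opts p a \<longrightarrow> \<not> chain_start p a')"

text \<open>Take the smallest \<open>y\<close> witnessing that \<open>a\<close> is pending. A
  winning move of \<open>p\<close> in \<open>a + y\<close> cannot be in \<open>a\<close>, since it
  would extend the chain, so it leads from \<open>y\<close> to some \<open>b\<close>. The partner of
  \<open>y\<close> and the minimality of \<open>y\<close> make \<open>b\<close> pending for the
  opponent.\<close>

lemma pending_step:
  assumes "pending p a"
  obtains b where "pending (opponent p) b" "second_safe p (a + b)"
proof -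
  let ?Q = "\<lambda>y. chain_start (opponent p) y \<and> wins_first p (a + y)"
  obtain y where y: "?Q y" and min: "\<And>z. size z < size y \<Longrightarrow> \<not> ?Q z"
    using assms ex_has_least_nat[of ?Q _ size] unfolding pending_def by (metis not_le)
  have a: "subposition a (K p)" "\<And>a'. a' |\<in>| opts p a \<Longrightarrow> \<not> chain_start p a'"
    using assms unfolding pending_def by blast+
  \<comment> \<open>Hence \<open>p\<close> wins \<open>a + y\<close> by an actual move and not for
    want of one.\<close>
  have "\<not> is_end p (a + y)" using chain_start_not_end[of "opponent p" y] y by simp
  then obtain Z where Z: "Z |\<in>| opts p (a + y)" "\<not> wins_first (opponent p) Z"
    using y by (meson wins_firstE)
  from Z(1) show thesis
  proof (cases rule: opts_plusE)
    case (1 a')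
    then have "chain_start p a'"
      using link[of p y a'] y Z a subposition_trans subposition_opts by blast
    then show ?thesis using a 1 by blast
  next
    case (2 b)
    have b: "subposition b (K (opponent p))"
      using 2 y chain_start_subposition subposition_trans subposition_opts by blast
    \<comment> \<open>So \<open>b\<close> differs from \<open>K (opponent p)\<close>, and
      \<open>pair_safe\<close> applies even if \<open>a\<close> is \<open>K p\<close>.\<close>
    have "size b < size (K (opponent p))"
      using size_opts[OF 2(1)] size_subposition chain_start_subposition y by fastforce
    then have "second_safe p (a + b)"
      using pair_safe[OF a(1) b] Z 2 by blast
    moreover have "pending (opponent p) b"
      unfolding pending_def
    proof (intro conjI allI impI)
      obtain x where x: "chain_start p x" "\<not> wins_first p (y + x)"
        using chain_start_partner[of "opponent p" y] y by auto
      have "wins_first (opponent p) (b + x)"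
        using x(2) wins_first_move[OF opts_plusI1[OF 2(1)], of x] by blast
      then show "\<exists>x. chain_start (opponent (opponent p)) x \<and> wins_first (opponent p) (b + x)"
        using x by auto
      \<comment> \<open>If \<open>b'\<close> started a chain, it would be a smaller choice for
        \<open>y\<close>.\<close>
      fix b' assume b': "b' |\<in>| opts (opponent p) b"
      then have "wins_first p (a + b')"
        using Z 2 wins_first_move[OF opts_plusI2[OF b'], of a] by auto
      moreover have "size b' < size y" using size_opts[OF b'] size_opts[OF 2(1)] by simp
      ultimately show "\<not> chain_start (opponent p) b'" using min by blast
    qed (fact b)
    ultimately show ?thesis using that by blast
  qed
qed

text \<open>The opponent moves from a smallest chain start \<open>x\<close> to \<open>a\<close>.
  Every answer of \<open>p\<close> inside \<open>a\<close> is smaller than \<open>x\<close>, so it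
  starts no chain, while the partner of \<open>x\<close> shows that \<open>p\<close> can still
  win.\<close>

lemma ex_pending: "\<exists>a. pending p a"
proof -
  obtain x where x: "chain_start p x" and min: "\<And>z. size z < size x \<Longrightarrow> \<not> chain_start p z"
    using base[of p] ex_has_least_nat[of "chain_start p" _ size] by (metis not_le)
  obtain a where a: "a |\<in>| opts (opponent p) x"
    using chain_start_not_end[OF x] not_is_endE by blast
  obtain y where y: "chain_start (opponent p) y" "\<not> wins_first (opponent p) (x + y)"
    using chain_start_partner[OF x] by blast
  have "wins_first p (a + y)"
    using y(2) wins_first_move[OF opts_plusI1[OF a], of y] by auto
  moreover have "\<not> chain_start p a'" if "a' |\<in>| opts p a" for a'
    using min[of a'] size_opts[OF a] size_opts[OF that] by simp
  ultimately show ?thesis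
    unfolding pending_def
    using y a x chain_start_subposition subposition_trans subposition_opts by blast
qed

text \<open>
  Iterating the step on the finitely many pending positions closes a cycle, whose sum can be
  grouped both into pairs safe for \<open>p\<close> and into pairs safe for the opponent.
\<close>

lemma contradiction: False
proof -
  define A where "A = {a. pending Left a}"
  \<comment> \<open>\<open>S\<close> is the sum of the pending positions strictly between
    \<open>a\<close> and \<open>a'\<close> along the row.\<close>
  define D where "D = (\<lambda>a a'. \<exists>S. second_safe Left (a + S) \<and> second_safe Right (S + a'))"
  have "finite A"
    unfolding A_def by (rule finite_subset[OF _ finite_subpositions[of "K Left"]]) (auto simp: pending_def)
  moreover have "A \<noteq> {}" using ex_pending by (auto simp: A_def)
  \<comment> \<open>Otherwise \<open>a + S\<close> is second safe for both players: Right then wins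
    it moving first, which Left's safety forbids.\<close>
  moreover have irrefl: "\<not> D a a" for a
    using second_safe_wins_first[of Right] second_safe_wins[of Left]
    by (auto simp: D_def game_plus_commute)
  moreover have trans: "D a c" if ab: "D a b" and bc: "D b c" for a b c
  proof -
    obtain S T where S: "second_safe Left (a + S)" "second_safe Right (S + b)"
      and T: "second_safe Left (b + T)" "second_safe Right (T + c)"
      using ab bc unfolding D_def by blast
    have "second_safe Left (a + (S + (b + T)))"
      using second_safe_plus[OF S(1) T(1)] by (simp add: game_plus_assoc)
    moreover have "second_safe Right (S + (b + T) + c)"
      using second_safe_plus[OF S(2) T(2)] by (simp add: game_plus_assoc)
    ultimately show ?thesis unfolding D_def by blast
  qed
  ultimately obtain m where m: "m \<in> A" "\<And>x. x \<in> A \<Longrightarrow> \<not> D m x"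
    using Finite_Set.bex_max_element[of A D] unfolding asymp_on_def transp_on_def by metis
  \<comment> \<open>Two pending steps from the maximal element \<open>m\<close> reach a pending
    \<open>c\<close> with \<open>D m c\<close>.\<close>
  obtain b where b: "pending Right b" "second_safe Left (m + b)"
    using m(1) pending_step[of Left m] unfolding A_def by auto
  obtain c where "pending Left c" "second_safe Right (b + c)"
    using b(1) pending_step[of Right b] by auto
  then show False using b m(2) unfolding A_def D_def by blast
qed

end

text \<open>A minimal counterexample is a \<open>critical_pair\<close>: by minimality all smaller
  sums of subpositions are strictly P-free, and there winning moving second is the same as being
  second safe.\<close>

lemma wins_first_plus_of_strictly_P_free:
  assumes "strictly_P_free G" "blocking G" "strictly_P_free H" "blocking H"
  shows "\<exists>p. wins_first p (G + H)"
  using assms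
proof (induction "size G + size H" arbitrary: G H rule: less_induct)
  case less
  note G = less.prems(1,2) and H = less.prems(3,4)
  show ?case
  proof (rule ccontr)
    assume "\<nexists>p. wins_first p (G + H)"
    then have lose: "\<not> wins_first p (G + H)" "\<not> wins_first p (H + G)" for p
      by (auto simp: game_plus_commute)
    have safe_sum: "\<not> (first_safe p X \<and> second_safe p Y)" if "{X, Y} = {G, H}" for p X Y
      using that lose first_safe_plus first_safe_wins by (metis doubleton_eq_iff)
    have end_sum: "\<not> (is_end p X \<and> first_safe p Y)" if "{X, Y} = {G, H}" for p X Y
    proof
      assume *: "is_end p X \<and> first_safe p Y"
      then have "blocked_end p X"
        using that G H unfolding blocking_def by (metis doubleton_eq_iff subposition_refl)
      then have "wins_first p (X + Y)" using * blocked_plus_first_safe first_safe_wins by blast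
      then show False using that lose by (metis doubleton_eq_iff)
    qed
    \<comment> \<open>This decides which player gets \<open>G\<close> as \<open>K p\<close>. If both
      players win \<open>G\<close> moving first, the same holds for \<open>H\<close> and either
      choice works. Otherwise one player wins \<open>G\<close> moving second, and the other must win
      \<open>H\<close> moving second.\<close>
    have "\<exists>p. first_safe p G \<and> first_safe (opponent p) H \<and>
        \<not> is_end (opponent p) G \<and> \<not> is_end p H"
    proof -
      obtain p where p: "wins_first p G" using G strictly_P_free_iff subposition_refl by blast
      show ?thesis
      proof (cases "wins_first (opponent p) G")
        case True
        have fG: "first_safe r G" for r
          using True p G first_safe_of_wins by (metis opponent.simps player.exhaust)
        then have fH: "first_safe r H" for r
          using safe_sum[of G H] second_safe_of_wins[OF H] first_safe_of_wins[OF H]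
          by (metis opponent_opponent)
        show ?thesis using fG fH end_sum[of G H] end_sum[of H G] by (metis insert_commute)
      next
        case False
        then have sG: "second_safe p G" using second_safe_of_wins G by blast
        have "\<not> wins_first p H"
          using safe_sum[of H G] sG first_safe_of_wins[OF H] by blast
        then have "second_safe (opponent p) H" using second_safe_of_wins[OF H, of "opponent p"] by simp
        then show ?thesis
          using sG second_safe_not_end[of "opponent p" H] second_safe_not_end second_safe_imp_first_safe
          by (metis opponent_opponent)
      qed
    qed
    then obtain p where p: "first_safe p G" "first_safe (opponent p) H"
      "\<not> is_end (opponent p) G" "\<not> is_end p H" by blast
    define K where "K = (\<lambda>q. if q = p then G else H)"
    have K: "K p = G" "K (opponent p) = H" by (auto simp: K_def)
    have q: "q = p \<or> q = opponent p" for q by (metis opponent.simps player.exhaust)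
    \<comment> \<open>The induction hypothesis covers every subposition of such a sum, since its
      size is below that of \<open>G + H\<close>.\<close>
    have small: "strictly_P_free (X + Y) \<and> blocking (X + Y)"
      if XY: "subposition X G" "subposition Y H" "X \<noteq> G \<or> Y \<noteq> H" for X Y
    proof
      show "blocking (X + Y)" using blocking_plus blocking_subposition XY G H by blast
      have "\<exists>p. wins_first p Z" if "subposition Z (X + Y)" for Z
      proof -
        obtain X' Y' where Z: "subposition X' X" "subposition Y' Y" "Z = X' + Y'"
          using \<open>subposition Z (X + Y)\<close> by (rule subposition_plusE)
        have "size X' + size Y' < size G + size H"
          using size_subposition[OF Z(1)] size_subposition[OF Z(2)]
            size_subposition[OF XY(1)] size_subposition[OF XY(2)] XY(3) by auto
        moreover have "subposition X' G" "subposition Y' H"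
          using Z XY subposition_trans by blast+
        ultimately show ?thesis
          using less.hyps[of X' Y'] Z(3) G H strictly_P_free_subposition blocking_subposition by blast
      qed
      then show "strictly_P_free (X + Y)" by (simp add: strictly_P_free_iff)
    qed
    have "critical_pair K"
    proof
      fix r x y
      assume *: "subposition y (K r)" "subposition x (K (opponent r))"
        "y \<noteq> K r \<or> x \<noteq> K (opponent r)" "\<not> wins_first (opponent r) (y + x)"
      have "strictly_P_free (y + x) \<and> blocking (y + x)"
        using q[of r] * small[of y x] small[of x y] K by (auto simp: game_plus_commute)
      then show "second_safe r (y + x)" using * second_safe_of_wins by blast
    next
      fix r
      show "\<not> wins_first q (K r + K (opponent r))" for q using q[of r] lose K by auto
      show "first_safe r (K r)" using q[of r] p K by auto
      show "\<not> is_end (opponent r) (K r)" using q[of r] p K by auto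
      show "blocking (K r)" using G H by (auto simp: K_def)
    qed
    then show False by (rule critical_pair.contradiction)
  qed
qed

lemma strictly_P_free_plus:
  assumes "strictly_P_free G" "blocking G" "strictly_P_free H" "blocking H"
  shows "strictly_P_free (G + H)"
  unfolding strictly_P_free_iff
proof (intro allI impI)
  fix X assume "subposition X (G + H)"
  then obtain G' H' where "subposition G' G" "subposition H' H" "X = G' + H'"
    by (rule subposition_plusE)
  then show "\<exists>p. wins_first p X"
    using assms wins_first_plus_of_strictly_P_free blocking_subposition strictly_P_free_subposition
    by blast
qed

section \<open>Conjugates as inverses\<close>

function conjugate :: "game \<Rightarrow> game" where
  "conjugate G = Game (conjugate |`| right_opts G) (conjugate |`| left_opts G)"
  by pat_completeness auto
termination
  by (relation "measure size") (auto dest: size_left_opts size_right_opts)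

declare conjugate.simps [simp del]

lemma opts_conjugate: "opts p (conjugate G) = conjugate |`| opts (opponent p) G"
  by (cases p) (subst conjugate.simps, simp)+

lemma is_end_conjugate [simp]: "is_end p (conjugate G) \<longleftrightarrow> is_end (opponent p) G"
  by (simp add: is_end_def opts_conjugate)

lemma conjugate_conjugate [simp]: "conjugate (conjugate G) = G"
proof (induction "size G" arbitrary: G rule: less_induct)
  case less
  have "(conjugate \<circ> conjugate) |`| opts p G = id |`| opts p G" for p
    by (intro fset.map_cong refl) (auto intro!: less dest: size_opts)
  then show ?case by (intro game_eqI) (simp add: opts_conjugate)
qed

lemma conjugate_plus: "conjugate (G + H) = conjugate G + conjugate H"
proof (induction "size G + size H" arbitrary: G H rule: less_induct)
  case less
  have "opts p (conjugate (G + H)) = opts p (conjugate G + conjugate H)" for p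
  proof -
    have "(\<lambda>G'. conjugate (G' + H)) |`| opts (opponent p) G =
        (\<lambda>G'. conjugate G' + conjugate H) |`| opts (opponent p) G"
      by (intro fset.map_cong refl less) (auto dest: size_opts)
    moreover have "(\<lambda>H'. conjugate (G + H')) |`| opts (opponent p) H =
        (\<lambda>H'. conjugate G + conjugate H') |`| opts (opponent p) H"
      by (intro fset.map_cong refl less) (auto dest: size_opts)
    ultimately show ?thesis
      by (simp add: opts_plus opts_conjugate fimage_funion comp_def)
  qed
  then show ?case by (rule game_eqI)
qed

lemma wins_first_conjugate: "wins_first p (conjugate G) \<longleftrightarrow> wins_first (opponent p) G"
proof (induction "size G" arbitrary: p G rule: less_induct)
  case less
  have "(\<exists>G'|\<in>|opts (opponent p) G. \<not> wins_first (opponent p) (conjugate G')) \<longleftrightarrow>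
      (\<exists>G'|\<in>|opts (opponent p) G. \<not> wins_first p G')"
    using less size_opts by (metis opponent_opponent)
  then show ?case
    by (subst (1 2) wins_first.simps) (simp add: opts_conjugate)
qed

lemma subposition_conjugate: "subposition H (conjugate G) \<Longrightarrow> subposition (conjugate H) G"
proof (induction rule: subposition_induct)
  case (step K K' p)
  then have "conjugate K' |\<in>| opts (opponent p) (conjugate K)"
    by (simp add: opts_conjugate)
  then show ?case using step subposition_opts subposition_trans by blast
qed simp

lemma blocked_end_conjugate: "blocked_end p X \<Longrightarrow> blocked_end (opponent p) (conjugate X)"
proof (induction rule: blocked_end.induct)
  case (1 X)
  show ?case
    by (rule blocked_end.intros) (use 1 in \<open>fastforce simp: opts_conjugate\<close>)+
qed

lemma blocking_conjugate: "blocking G \<Longrightarrow> blocking (conjugate G)"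
  unfolding blocking_def
  by (metis blocked_end_conjugate conjugate_conjugate is_end_conjugate opponent_opponent
      subposition_conjugate)

lemma strictly_P_free_conjugate: "strictly_P_free G \<Longrightarrow> strictly_P_free (conjugate G)"
  unfolding strictly_P_free_iff
  by (metis conjugate_conjugate subposition_conjugate wins_first_conjugate)

text \<open>The sum is its own conjugate, so either both players win it moving first or neither
  does; strict P-freeness of the sum excludes the latter.\<close>

lemma first_safe_plus_conjugate:
  assumes "strictly_P_free G" "blocking G"
  shows "first_safe p (G + conjugate G)"
proof -
  let ?Z = "G + conjugate G"
  have Z: "strictly_P_free ?Z" "blocking ?Z"
    using assms strictly_P_free_plus strictly_P_free_conjugate blocking_plus blocking_conjugate
    by blast+
  have "conjugate ?Z = ?Z" by (simp add: conjugate_plus game_plus_commute)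
  then have "wins_first p ?Z"
    using wins_first_conjugate[of p ?Z] strictly_P_free_wins[OF Z(1), of p] by auto
  then show ?thesis using Z first_safe_of_wins by blast
qed

text \<open>\<open>p\<close> follows the strategy for \<open>X\<close> and mirrors each opposing
  move in \<open>G + conjugate G\<close>, which leaves a sum of the same form for an option of
  \<open>G\<close>; hence the induction on \<open>G\<close> as well.\<close>

lemma wins_first_plus_conjugate_imp:
  assumes "strictly_P_free G" "blocking G" "blocking X"
  shows "(wins_first p X \<longrightarrow> wins_first p (X + (G + conjugate G))) \<and>
    (\<not> wins_first (opponent p) X \<longrightarrow> \<not> wins_first (opponent p) (X + (G + conjugate G)))"
  using assms
proof (induction "size G + size X" arbitrary: G X rule: less_induct)
  case less
  let ?Z = "G + conjugate G"
  have IH: "(wins_first p X' \<longrightarrow> wins_first p (X' + ?Z)) \<and>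
    (\<not> wins_first (opponent p) X' \<longrightarrow> \<not> wins_first (opponent p) (X' + ?Z))"
    if "X' |\<in>| opts q X" for q X'
    using less.hyps[of G X'] less.prems size_opts[OF that]
      blocking_subposition[OF _ subposition_opts[OF that]] by simp
  have IHG: "\<not> wins_first (opponent p) (X + (G' + conjugate G'))"
    if "G' |\<in>| opts q G" "\<not> wins_first (opponent p) X" for q G'
    using less.hyps[of G' X] less.prems that(2) size_opts[OF that(1)]
      blocking_subposition[OF _ subposition_opts[OF that(1)]]
      strictly_P_free_subposition[OF _ subposition_opts[OF that(1)]] by simp
  have "wins_first p (X + ?Z)" if "wins_first p X"
    using that
  proof (cases rule: wins_firstE)
    \<comment> \<open>When \<open>X\<close> offers \<open>p\<close> no move, plain mirroring gives
      out. As \<open>X\<close> is a blocked end, \<open>p\<close> continues with the first safe sum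
      \<open>G + conjugate G\<close>.\<close>
    case 1
    then have "blocked_end p X"
      using less.prems(3) unfolding blocking_def by simp
    then show ?thesis
      using blocked_plus_first_safe first_safe_plus_conjugate first_safe_wins less.prems by blast
  next
    case (2 X')
    then show ?thesis using IH wins_first_move[OF opts_plusI1[OF 2(1)]] by blast
  qed
  moreover have "\<not> wins_first (opponent p) (X + ?Z)" if X: "\<not> wins_first (opponent p) X"
  proof
    assume "wins_first (opponent p) (X + ?Z)"
    then show False
    proof (cases rule: wins_firstE)
      case 1
      then show ?thesis using X wins_first_end by auto
    next
      case (2 W)
      from 2(1) show ?thesis
      proof (cases rule: opts_plusE)
        case (1 X')
        have "wins_first p X'" using X wins_first_move[OF 1(1)] by auto
        then show ?thesis using IH 1 2 by auto
      next
        case (2 V)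
        \<comment> \<open>\<open>U\<close> is the position after the mirrored reply.\<close>
        have "\<exists>U. U |\<in>| opts p V \<and> (\<exists>G' q. G' |\<in>| opts q G \<and> U = G' + conjugate G')"
          using 2(1)
        proof (cases rule: opts_plusE)
          case (1 G')
          then have "conjugate G' |\<in>| opts p (conjugate G)" by (simp add: opts_conjugate)
          then show ?thesis using 1 opts_plusI2 by blast
        next
          case (2 V')
          then obtain G' where "G' |\<in>| opts p G" "V' = conjugate G'"
            by (auto simp: opts_conjugate)
          then show ?thesis using 2 opts_plusI1 by blast
        qed
        then obtain U where "U |\<in>| opts p V" "\<not> wins_first (opponent p) (X + U)"
          using IHG X by blast
        then have "wins_first p W" using 2 opts_plusI2 wins_first_move by blast
        then show ?thesis using \<open>\<not> wins_first (opponent (opponent p)) W\<close> by simp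
      qed
    qed
  qed
  ultimately show ?case by blast
qed

lemma wins_first_plus_conjugate:
  assumes "strictly_P_free G" "blocking G" "blocking X"
  shows "wins_first p (G + conjugate G + X) \<longleftrightarrow> wins_first p X"
  \<comment> \<open>The converse implication is the moving-second part for the opponent.\<close>
  using wins_first_plus_conjugate_imp[OF assms, of p]
    wins_first_plus_conjugate_imp[OF assms, of "opponent p"]
  unfolding game_plus_commute[of "G + conjugate G" X] opponent_opponent by blast

section \<open>The group of invertible classes\<close>

lemma equiv_mod_iff: "equiv_mod \<A> G H \<longleftrightarrow> (\<forall>X\<in>\<A>. outcome (G + X) = outcome (H + X))"
  unfolding equiv_mod_def geq_mod_def by (auto intro: antisym)

lemma equiv_mod_refl [simp]: "equiv_mod \<A> G G"
  and equiv_mod_sym: "equiv_mod \<A> G H \<Longrightarrow> equiv_mod \<A> H G"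
  and equiv_mod_trans: "equiv_mod \<A> G H \<Longrightarrow> equiv_mod \<A> H K \<Longrightarrow> equiv_mod \<A> G K"
  by (auto simp: equiv_mod_iff)

lemma equiv_equiv_rel: "equiv \<A> (equiv_rel \<A>)"
  by (rule equivI)
    (auto simp: equiv_rel_def refl_on_def sym_def trans_def intro: equiv_mod_sym equiv_mod_trans)

locale game_monoid =
  fixes \<A> :: "game set"
  assumes zero_mem [simp]: "0 \<in> \<A>"
    and plus_mem [simp]: "G \<in> \<A> \<Longrightarrow> H \<in> \<A> \<Longrightarrow> G + H \<in> \<A>"
begin

text \<open>Testing \<open>G + H\<close> against \<open>X\<close> amounts to testing
  \<open>G\<close> against \<open>H + X\<close>. The summand absorbed into the test, first
  \<open>H\<close> and then \<open>G'\<close>, has to lie in the monoid.\<close>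

lemma equiv_mod_plus:
  assumes "H \<in> \<A>" "G' \<in> \<A>" "equiv_mod \<A> G G'" "equiv_mod \<A> H H'"
  shows "equiv_mod \<A> (G + H) (G' + H')"
proof -
  have "equiv_mod \<A> (G + H) (G' + H)"
    using assms by (simp add: equiv_mod_iff game_plus_assoc)
  moreover have "equiv_mod \<A> (H + G') (H' + G')"
    using assms by (simp add: equiv_mod_iff game_plus_assoc)
  ultimately show ?thesis
    unfolding game_plus_commute[of H G'] game_plus_commute[of H' G'] by (rule equiv_mod_trans)
qed

abbreviation cls :: "game \<Rightarrow> game set" where "cls G \<equiv> equiv_rel \<A> `` {G}"

abbreviation IC :: "game set monoid" where "IC \<equiv> invertible_classes \<A>"

lemma cls_eq_iff: "G \<in> \<A> \<Longrightarrow> H \<in> \<A> \<Longrightarrow> cls G = cls H \<longleftrightarrow> equiv_mod \<A> G H"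
  using eq_equiv_class_iff[OF equiv_equiv_rel] by (simp add: equiv_rel_def)

text \<open>All representatives give the same class, so the union defining the product collapses to
  it.\<close>

lemma mult_cls:
  assumes "G \<in> \<A>" "H \<in> \<A>"
  shows "cls G \<otimes>\<^bsub>IC\<^esub> cls H = cls (G + H)"
proof -
  have "cls (G' + H') = cls (G + H)" if "G' \<in> cls G" "H' \<in> cls H" for G' H'
    using that assms equiv_mod_plus
    by (subst cls_eq_iff) (auto simp: equiv_rel_def intro: equiv_mod_sym)
  moreover have "G \<in> cls G" "H \<in> cls H" using assms by (auto simp: equiv_rel_def)
  ultimately have "(\<Union>G'\<in>cls G. \<Union>H'\<in>cls H. cls (G' + H')) = cls (G + H)"
    by blast
  then show ?thesis by (simp add: invertible_classes_def)
qed

lemma one_cls: "\<one>\<^bsub>IC\<^esub> = cls 0"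
  by (simp add: invertible_classes_def)

lemma carrier_cls: "carrier IC = cls ` invertibles \<A>"
  by (auto simp: invertible_classes_def quotient_def)

lemma invertibles_mem: "G \<in> invertibles \<A> \<Longrightarrow> G \<in> \<A>"
  by (simp add: invertibles_def invertible_in_def)

lemma zero_invertible: "0 \<in> invertibles \<A>"
  by (auto simp: invertibles_def invertible_in_def intro!: bexI[of _ 0])

lemma plus_invertible:
  assumes "G \<in> invertibles \<A>" "H \<in> invertibles \<A>"
  shows "G + H \<in> invertibles \<A>"
proof -
  obtain G' H' where *: "G \<in> \<A>" "H \<in> \<A>" "G' \<in> \<A>" "H' \<in> \<A>"
    "equiv_mod \<A> (G + G') 0" "equiv_mod \<A> (H + H') 0"
    using assms by (auto simp: invertibles_def invertible_in_def)
  then have "equiv_mod \<A> (G + G' + (H + H')) (0 + 0)"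
    by (intro equiv_mod_plus) auto
  moreover have "G + G' + (H + H') = G + H + (G' + H')" by (simp add: game_plus_ac)
  ultimately show ?thesis
    using * by (auto simp: invertibles_def invertible_in_def intro!: bexI[of _ "G' + H'"])
qed

lemma inverse_invertible:
  assumes "G \<in> \<A>" "H \<in> \<A>" "equiv_mod \<A> (G + H) 0"
  shows "G \<in> invertibles \<A>"
  using assms by (auto simp: invertibles_def invertible_in_def)

lemma group_invertible_classes: "group IC"
proof (rule groupI)
  show "x \<otimes>\<^bsub>IC\<^esub> y \<in> carrier IC" if "x \<in> carrier IC" "y \<in> carrier IC" for x y
    using that by (auto simp: carrier_cls mult_cls invertibles_mem plus_invertible)
  show "\<one>\<^bsub>IC\<^esub> \<in> carrier IC"
    by (auto simp: carrier_cls one_cls zero_invertible)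
  show "x \<otimes>\<^bsub>IC\<^esub> y \<otimes>\<^bsub>IC\<^esub> z = x \<otimes>\<^bsub>IC\<^esub> (y \<otimes>\<^bsub>IC\<^esub> z)"
    if "x \<in> carrier IC" "y \<in> carrier IC" "z \<in> carrier IC" for x y z
    using that by (auto simp: carrier_cls mult_cls invertibles_mem game_plus_assoc)
  show "\<one>\<^bsub>IC\<^esub> \<otimes>\<^bsub>IC\<^esub> x = x" if "x \<in> carrier IC" for x
    using that by (auto simp: carrier_cls one_cls mult_cls invertibles_mem)
  show "\<exists>y\<in>carrier IC. y \<otimes>\<^bsub>IC\<^esub> x = \<one>\<^bsub>IC\<^esub>" if x: "x \<in> carrier IC" for x
  proof -
    obtain G H where "x = cls G" "G \<in> \<A>" "H \<in> \<A>" "equiv_mod \<A> (G + H) 0"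
      using x unfolding carrier_cls invertibles_def invertible_in_def by blast
    then have *: "x = cls G" "G \<in> \<A>" "H \<in> \<A>" "equiv_mod \<A> (H + G) 0"
      unfolding game_plus_commute[of G H] .
    then have "cls H \<otimes>\<^bsub>IC\<^esub> x = \<one>\<^bsub>IC\<^esub>" by (simp add: mult_cls one_cls cls_eq_iff)
    then show ?thesis using * inverse_invertible by (auto simp: carrier_cls)
  qed
qed

text \<open>Inverses found inside \<open>T\<close> put \<open>T\<close> among the invertibles, and
  uniqueness of inverses in the group identifies the class of \<open>H\<close> with the inverse of
  the class of \<open>G\<close>.\<close>

lemma subgroup_of_invertiblesI:
  assumes T: "T \<subseteq> \<A>" "0 \<in> T" "\<And>G H. G \<in> T \<Longrightarrow> H \<in> T \<Longrightarrow> G + H \<in> T"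
    and inverse: "\<And>G. G \<in> T \<Longrightarrow> \<exists>H\<in>T. equiv_mod \<A> (G + H) 0"
  shows "subgroup_of_invertibles T \<A>"
proof -
  interpret group IC by (rule group_invertible_classes)
  have TI: "T \<subseteq> invertibles \<A>"
    using T(1) inverse inverse_invertible by blast
  have quot: "T // equiv_rel \<A> = cls ` T" by (auto simp: quotient_def)
  have "subgroup (cls ` T) IC"
  proof (rule subgroupI)
    show "cls ` T \<subseteq> carrier IC" using TI by (auto simp: carrier_cls)
    show "cls ` T \<noteq> {}" using T(2) by blast
    show "inv\<^bsub>IC\<^esub> x \<in> cls ` T" if x: "x \<in> cls ` T" for x
    proof -
      obtain G H where "x = cls G" "G \<in> T" "H \<in> T" "equiv_mod \<A> (G + H) 0"
        using x inverse by blast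
      then have *: "x = cls G" "G \<in> T" "H \<in> T" "equiv_mod \<A> (H + G) 0"
        unfolding game_plus_commute[of G H] .
      then have "cls H \<otimes>\<^bsub>IC\<^esub> x = \<one>\<^bsub>IC\<^esub>" "x \<in> carrier IC" "cls H \<in> carrier IC"
        using T(1) TI by (auto simp: mult_cls one_cls cls_eq_iff carrier_cls subset_iff)
      then show ?thesis using * inv_equality by simp
    qed
    show "x \<otimes>\<^bsub>IC\<^esub> y \<in> cls ` T" if "x \<in> cls ` T" "y \<in> cls ` T" for x y
      using that T(1,3) by (auto simp: mult_cls subset_iff)
  qed
  then show ?thesis
    unfolding subgroup_of_invertibles_def using TI quot group_invertible_classes by simp
qed

end

section \<open>The P-free part of the blocking games\<close>

interpretation blocking: game_monoid blocking_games
  by standard (auto simp: blocking_games_def blocking_zero blocking_plus)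

lemma equiv_mod_plus_conjugate:
  assumes "strictly_P_free G" "G \<in> blocking_games"
  shows "equiv_mod blocking_games (G + conjugate G) 0"
  using assms
  by (auto simp: equiv_mod_iff blocking_games_def outcome_def wins_first_plus_conjugate)

lemma strictly_P_free_zero: "strictly_P_free 0"
  unfolding strictly_P_free_iff using subposition_zeroD wins_first_end is_end_zero by blast

lemma mem_P_free_part: "G \<in> \<A> \<Longrightarrow> strictly_P_free G \<Longrightarrow> G \<in> P_free_part \<A>"
  unfolding P_free_part_def by (auto intro: bexI[of _ G])

text \<open>\<open>G\<close> itself may have subpositions of outcome P, so the inverse is the
  conjugate of an equivalent strictly P-free \<open>H\<close>.\<close>

lemma P_free_part_inverse:
  assumes "G \<in> P_free_part blocking_games"
  shows "\<exists>H \<in> P_free_part blocking_games. equiv_mod blocking_games (G + H) 0"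
proof -
  obtain H where H: "H \<in> blocking_games" "strictly_P_free H" "equiv_mod blocking_games G H"
    using assms by (auto simp: P_free_part_def)
  let ?C = "conjugate H"
  have C: "?C \<in> blocking_games"
    using H by (simp add: blocking_games_def blocking_conjugate)
  have "equiv_mod blocking_games (G + ?C) (H + ?C)"
    using H C by (intro blocking.equiv_mod_plus) auto
  moreover have "equiv_mod blocking_games (H + ?C) 0"
    using H by (simp add: equiv_mod_plus_conjugate)
  moreover have "?C \<in> P_free_part blocking_games"
    using H C by (simp add: mem_P_free_part strictly_P_free_conjugate)
  ultimately show ?thesis using equiv_mod_trans by blast
qed

lemma P_free_part_plus:
  assumes "G \<in> P_free_part blocking_games" "H \<in> P_free_part blocking_games"
  shows "G + H \<in> P_free_part blocking_games"
proof -
  obtain G' H' where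
    G': "G \<in> blocking_games" "G' \<in> blocking_games" "strictly_P_free G'"
      "equiv_mod blocking_games G G'" and
    H': "H \<in> blocking_games" "H' \<in> blocking_games" "strictly_P_free H'"
      "equiv_mod blocking_games H H'"
    using assms unfolding P_free_part_def by blast
  have "strictly_P_free (G' + H')"
    using G' H' strictly_P_free_plus by (simp add: blocking_games_def)
  moreover have "equiv_mod blocking_games (G + H) (G' + H')"
    using G' H' by (intro blocking.equiv_mod_plus)
  ultimately show ?thesis
    using G' H' blocking.plus_mem unfolding P_free_part_def by blast
qed

theorem theorem4p12:
  shows "(\<forall>G \<in> P_free_part blocking_games. invertible_in blocking_games G) \<and>
         subgroup_of_invertibles (P_free_part blocking_games) blocking_games"
proof -
  have "subgroup_of_invertibles (P_free_part blocking_games) blocking_games"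
  proof (rule blocking.subgroup_of_invertiblesI)
    show "P_free_part blocking_games \<subseteq> blocking_games" by (auto simp: P_free_part_def)
    show "0 \<in> P_free_part blocking_games" by (simp add: mem_P_free_part strictly_P_free_zero)
  qed (fact P_free_part_plus P_free_part_inverse)+
  then show ?thesis
    by (auto simp: subgroup_of_invertibles_def invertibles_def)
qed

end
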